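(* Let $\Omega$ be the open unit disk in $\mathbb{R}^2$ and let $\gamma\in L^2(\Omega)$ be real-valued with angular Fourier expansion in polar coordinates $$\gamma(r,\phi)=a_0(r)+\sum_{n=1}^\infty\big(a_n(r)\cos(n\phi)+b_n(r)\sin(n\phi)\big).$$ Then for all integers $i,j\ge1$ $$K^{cc}_{i,j}=K^{ss}_{i,j}=ij\pi\,\zeta_{i,j}\int_0^1 r^{i+j-1}a_{|i-j|}(r)\,dr,$$ $$K^{cs}_{i,j}=K^{sc}_{j,i}=ij\pi\,\operatorname{sign}(j-i)\int_0^1 r^{i+j-1}b_{|i-j|}(r)\,dr,$$ where $\zeta_{i,j}=1$ if $|i-j|\ge1$ and $\zeta_{i,j}=2$ if $i=j$, and $\operatorname{sign}$ is the sign function with $\operatorname{sign}(0)=0$.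
   Context: For boundary functions $f,g$ on the unit circle, $\langle\Lambda_1' f,g\rangle:=\int_\Omega\gamma\,\nabla u_f\cdot\nabla u_g\,dx$, where $u_f$ is the harmonic function in $\Omega$ with boundary values $f$ (so $u_f=r^n\cos(n\phi)$, resp. $r^n\sin(n\phi)$, for $f=\cos(n\phi)$, resp. $\sin(n\phi)$). For $i,j\ge1$: $K^{cc}_{i,j}=\langle\Lambda_1'\cos(i\phi),\cos(j\phi)\rangle$, $K^{ss}_{i,j}=\langle\Lambda_1'\sin(i\phi),\sin(j\phi)\rangle$, $K^{sc}_{i,j}=\langle\Lambda_1'\sin(i\phi),\cos(j\phi)\rangle$, $K^{cs}_{i,j}=\langle\Lambda_1'\cos(i\phi),\sin(j\phi)\rangle$. The coefficients satisfy $\sum_{n\ge0}\int_0^1a_n^2\,r\,dr+\sum_{n\ge1}\int_0^1b_n^2\,r\,dr<\infty$, which is equivalent to $\gamma\in L^2(\Omega)$. Convention: $b_0:=0$. *)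

theory Defs
  imports "HOL-Analysis.Analysis"
begin

definition gradient :: "('a::real_inner \<Rightarrow> real) \<Rightarrow> 'a \<Rightarrow> 'a" where
  "gradient u x = (THE D. GDERIV u x :> D)"

definition C2_on :: "'a::euclidean_space set \<Rightarrow> ('a \<Rightarrow> real) \<Rightarrow> bool" where
  "C2_on S u \<longleftrightarrow>
     (\<forall>x\<in>S. u differentiable at x \<and> gradient u differentiable at x) \<and>
     (\<forall>h. continuous_on S (\<lambda>x. frechet_derivative (gradient u) (at x) h))"

definition laplacian :: "('a::euclidean_space \<Rightarrow> real) \<Rightarrow> 'a \<Rightarrow> real" where
  "laplacian u x = (\<Sum>e\<in>Basis. frechet_derivative (gradient u) (at x) e \<bullet> e)"

definition harmonic_on :: "'a::euclidean_space set \<Rightarrow> ('a \<Rightarrow> real) \<Rightarrow> bool" where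
  "harmonic_on S u \<longleftrightarrow> C2_on S u \<and> (\<forall>x\<in>S. laplacian u x = 0)"

abbreviation unit_disk :: "(real ^ 2) set" where
  "unit_disk \<equiv> ball 0 1"

definition polar_angle :: "real ^ 2 \<Rightarrow> real" where
  "polar_angle x = Arg (Complex (x $ 1) (x $ 2))"

(* Functions on the unit circle are given as functions of the angle. *)
definition solves_dirichlet :: "(real \<Rightarrow> real) \<Rightarrow> (real ^ 2 \<Rightarrow> real) \<Rightarrow> bool" where
  "solves_dirichlet f u \<longleftrightarrow>
     harmonic_on unit_disk u \<and> continuous_on (closure unit_disk) u \<and>
     (\<forall>\<phi>. u (vector [cos \<phi>, sin \<phi>]) = f \<phi>)"

(* The conditions determine the function on the closed disk only; outside it the value is
   irrelevant, hence SOME rather than THE. *)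
definition harmonic_extension :: "(real \<Rightarrow> real) \<Rightarrow> real ^ 2 \<Rightarrow> real" where
  "harmonic_extension f = (SOME u. solves_dirichlet f u)"

definition DN_derivative :: "(real ^ 2 \<Rightarrow> real) \<Rightarrow> (real \<Rightarrow> real) \<Rightarrow> (real \<Rightarrow> real) \<Rightarrow> real" where
  "DN_derivative \<gamma> f g =
     (LINT x | lebesgue_on unit_disk.
        \<gamma> x * (gradient (harmonic_extension f) x \<bullet> gradient (harmonic_extension g) x))"

definition K_cc :: "(real ^ 2 \<Rightarrow> real) \<Rightarrow> nat \<Rightarrow> nat \<Rightarrow> real" where
  "K_cc \<gamma> i j = DN_derivative \<gamma> (\<lambda>\<phi>. cos (real i * \<phi>)) (\<lambda>\<phi>. cos (real j * \<phi>))"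

definition K_ss :: "(real ^ 2 \<Rightarrow> real) \<Rightarrow> nat \<Rightarrow> nat \<Rightarrow> real" where
  "K_ss \<gamma> i j = DN_derivative \<gamma> (\<lambda>\<phi>. sin (real i * \<phi>)) (\<lambda>\<phi>. sin (real j * \<phi>))"

definition K_sc :: "(real ^ 2 \<Rightarrow> real) \<Rightarrow> nat \<Rightarrow> nat \<Rightarrow> real" where
  "K_sc \<gamma> i j = DN_derivative \<gamma> (\<lambda>\<phi>. sin (real i * \<phi>)) (\<lambda>\<phi>. cos (real j * \<phi>))"

definition K_cs :: "(real ^ 2 \<Rightarrow> real) \<Rightarrow> nat \<Rightarrow> nat \<Rightarrow> real" where
  "K_cs \<gamma> i j = DN_derivative \<gamma> (\<lambda>\<phi>. cos (real i * \<phi>)) (\<lambda>\<phi>. sin (real j * \<phi>))"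

definition L2_on :: "'a::euclidean_space set \<Rightarrow> ('a \<Rightarrow> real) \<Rightarrow> bool" where
  "L2_on S f \<longleftrightarrow>
     f \<in> borel_measurable (lebesgue_on S) \<and> integrable (lebesgue_on S) (\<lambda>x. (f x)\<^sup>2)"

definition fourier_partial_sum ::
    "(nat \<Rightarrow> real \<Rightarrow> real) \<Rightarrow> (nat \<Rightarrow> real \<Rightarrow> real) \<Rightarrow> nat \<Rightarrow> real \<Rightarrow> real \<Rightarrow> real" where
  "fourier_partial_sum a b N r \<phi> =
     a 0 r + (\<Sum>n=1..N. a n r * cos (real n * \<phi>) + b n r * sin (real n * \<phi>))"

(* Equality of a square-integrable function with its angular Fourier series is understood as
   convergence of the partial sums in L^2 of the disk. The squared distance is a nonnegative
   extended integral, so that it cannot vanish for lack of integrability. *)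
definition has_angular_fourier_expansion ::
    "(real ^ 2 \<Rightarrow> real) \<Rightarrow> (nat \<Rightarrow> real \<Rightarrow> real) \<Rightarrow> (nat \<Rightarrow> real \<Rightarrow> real) \<Rightarrow> bool" where
  "has_angular_fourier_expansion \<gamma> a b \<longleftrightarrow>
     (\<forall>n. a n \<in> borel_measurable (lebesgue_on {0<..<1})) \<and>
     (\<forall>n. b n \<in> borel_measurable (lebesgue_on {0<..<1})) \<and>
     (\<lambda>N. \<integral>\<^sup>+x. ennreal ((\<gamma> x - fourier_partial_sum a b N (norm x) (polar_angle x))\<^sup>2)
            \<partial>lebesgue_on unit_disk) \<longlonglongrightarrow> 0"

definition zeta :: "nat \<Rightarrow> nat \<Rightarrow> real" where
  "zeta i j = (if i = j then 2 else 1)"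

end

theory Submission
  imports Defs
begin

text \<open>
  With \<open>z = x\<^sub>1 + \<i> x\<^sub>2\<close>, the harmonic extensions of the trigonometric functions are the real parts of
  \<open>z ^ n\<close> and \<open>- \<i> z ^ n\<close>; the maximum principle identifies the extension chosen in the definition
  with these. The gradient of \<open>Re F\<close> is the conjugate of \<open>F'\<close>, so the inner product of two such
  gradients is \<open>i j r ^ (i + j - 2)\<close> times a cosine or sine of \<open>(j - i) \<phi>\<close>. This weight is bounded,
  hence the partial sums of the Fourier series may be integrated against it term by term, and in
  polar coordinates orthogonality leaves the single coefficient of index \<open>\<bar>i - j\<bar>\<close>.
\<close>

subsection \<open>Harmonic extensions\<close>

text \<open>The extension is picked by \<open>SOME\<close> and is unspecified off the closed disk,
  but a gradient at a point of the open disk depends only on nearby values, so uniqueness inside the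
  disk suffices. Two facts shape the measure theory. The coefficients are merely Lebesgue
  measurable, and Lebesgue measure on the plane is the completion of the product measure, so
  separating radial from angular integrals passes through Borel representatives. Moreover
  \<open>a n\<close> and \<open>b n\<close> are square integrable only against r dr: the factor r
  that controls them near the origin is the Jacobian of polar coordinates, which also raises the
  exponent i + j - 2 of the gradients to i + j - 1. The factor \<open>zeta\<close> is 2 on the
  diagonal because the constant 1 integrates to 2 pi over a period, whereas the square of a
  nonconstant mode integrates to pi. The sign comes from the oddness of the sine.\<close>

lemma gradient_eqI:
  assumes "GDERIV u x :> D"
  shows "gradient u x = D"
  unfolding gradient_def
proof (rule the_equality)
  fix D' assume "GDERIV u x :> D'"
  then have "(\<lambda>h. inner h D') = (\<lambda>h. inner h D)"
    using assms has_derivative_unique unfolding gderiv_def by blast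
  then have "inner (D' - D) D' = inner (D' - D) D" by metis
  then have "inner (D' - D) (D' - D) = 0" by (simp add: inner_diff_right)
  then show "D' = D" by simp
qed (fact assms)

text \<open>Riesz representation: the derivative is the inner product with the vector whose
  coordinates are its values on the basis. This existence statement makes the \<open>THE\<close> in
  \<open>gradient\<close> meaningful.\<close>

lemma GDERIV_gradient:
  fixes u :: "'a::euclidean_space \<Rightarrow> real"
  assumes "u differentiable at x"
  shows "GDERIV u x :> gradient u x"
proof -
  obtain f where f: "(u has_derivative f) (at x)" using assms differentiable_def by blast
  define D where "D = (\<Sum>b\<in>Basis. f b *\<^sub>R b)"
  have lin: "linear f" using f has_derivative_linear by blast
  have "f = (\<lambda>h. inner h D)"
  proof
    fix h
    have "f h = f (\<Sum>b\<in>Basis. (h \<bullet> b) *\<^sub>R b)" by (simp add: euclidean_representation)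
    also have "\<dots> = (\<Sum>b\<in>Basis. (h \<bullet> b) * f b)"
      by (simp add: linear_sum[OF lin] linear_scale[OF lin])
    also have "\<dots> = inner h D" by (simp add: D_def inner_sum_right mult.commute)
    finally show "f h = inner h D" .
  qed
  then have "GDERIV u x :> D" using f by (simp add: gderiv_def)
  then show ?thesis using gradient_eqI by metis
qed

lemma gradient_cong_open:
  assumes "open S" "x \<in> S" "\<And>y. y \<in> S \<Longrightarrow> u y = v y" "GDERIV v x :> D"
  shows "gradient u x = D"
proof (rule gradient_eqI)
  show "GDERIV u x :> D"
    using assms has_derivative_transform_within_open unfolding gderiv_def by metis
qed

section \<open>Maximum principle and uniqueness\<close>

text \<open>At an interior maximum \<open>g'\<close> vanishes; its positive slope there makes it
  positive just to the right, so \<open>g\<close> increases beyond \<open>g 0\<close>. It will be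
  applied along a line through a maximum point in space.\<close>

lemma not_local_max_of_deriv2_pos:
  fixes g g' :: "real \<Rightarrow> real"
  assumes "d > 0"
    and "\<And>t. \<bar>t\<bar> < d \<Longrightarrow> (g has_real_derivative g' t) (at t)"
    and "(g' has_real_derivative l) (at 0)" and "l > 0"
    and "\<And>t. \<bar>t\<bar> < d \<Longrightarrow> g t \<le> g 0"
  shows False
proof -
  have "g' 0 = 0"
    using DERIV_local_max[of g "g' 0" 0 d] assms by auto
  then obtain d2 where d2: "d2 > 0" "\<And>h. 0 < h \<Longrightarrow> h < d2 \<Longrightarrow> g' h > 0"
    using DERIV_pos_inc_right[OF assms(3,4)] by auto
  define t where "t = min d d2 / 2"
  have t: "0 < t" "t < d" "t < d2" using assms(1) d2(1) by (auto simp: t_def min_def)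
  have "g 0 < g t"
  proof (rule DERIV_pos_imp_increasing_open[of 0 t g])
    show "continuous_on {0..t} g"
      using assms(2) t by (intro continuous_at_imp_continuous_on ballI) (auto intro!: DERIV_isCont[OF assms(2)])
    show "\<exists>y. (g has_real_derivative y) (at x) \<and> y > 0" if "0 < x" "x < t" for x
      using that t assms(2)[of x] d2(2)[of x] by auto
  qed (use t in auto)
  with assms(5)[of t] t show False by auto
qed

text \<open>Weak maximum principle: \<open>\<epsilon> * norm x ^ 2\<close> is added to make the Laplacian strictly positive.\<close>

lemma harmonic_on_le:
  fixes u w :: "'a::euclidean_space \<Rightarrow> real"
  assumes S: "open S" "bounded S"
    and u: "harmonic_on S u" "continuous_on (closure S) u"
    and w: "harmonic_on S w" "continuous_on (closure S) w"
    and le: "\<And>x. x \<in> frontier S \<Longrightarrow> u x \<le> w x"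
    and x1: "x1 \<in> S"
  shows "u x1 \<le> w x1"
proof (rule ccontr)
  assume "\<not> u x1 \<le> w x1"
  define \<delta> where "\<delta> = u x1 - w x1"
  have \<delta>: "\<delta> > 0" using \<open>\<not> u x1 \<le> w x1\<close> by (simp add: \<delta>_def)
  obtain B where B: "\<And>x. x \<in> closure S \<Longrightarrow> norm x \<le> B" "B > 0"
    using bounded_closure[OF S(2)] bounded_pos by blast
  \<comment> \<open>With this constant the perturbation is at most \<delta> / 2 on the closure, so
    it cannot lift a boundary point to the level \<delta> reached at \<open>x1\<close>.\<close>
  define \<epsilon> where "\<epsilon> = \<delta> / (2 * B\<^sup>2)"
  have \<epsilon>: "\<epsilon> > 0" using \<delta> B by (simp add: \<epsilon>_def)
  define p where "p x = u x - w x + \<epsilon> * (x \<bullet> x)" for x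
  have "compact (closure S)" using S by (simp add: compact_closure)
  moreover have "continuous_on (closure S) p"
    unfolding p_def by (intro continuous_intros u w)
  moreover have "closure S \<noteq> {}" using x1 by auto
  ultimately obtain x0 where x0: "x0 \<in> closure S" "\<And>y. y \<in> closure S \<Longrightarrow> p y \<le> p x0"
    using continuous_attains_sup by metis
  have "x0 \<notin> frontier S"
  proof
    assume fr: "x0 \<in> frontier S"
    have "(norm x0)\<^sup>2 \<le> B\<^sup>2" using B x0 by (intro power_mono) auto
    then have "\<epsilon> * (x0 \<bullet> x0) \<le> \<epsilon> * B\<^sup>2" using \<epsilon> by (simp add: power2_norm_eq_inner)
    also have "\<dots> = \<delta> / 2" using B by (simp add: \<epsilon>_def)
    finally have "p x0 \<le> \<delta> / 2" using le[OF fr] by (simp add: p_def)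
    moreover have "p x1 \<ge> \<delta>" using \<epsilon> by (simp add: p_def \<delta>_def)
    moreover have "p x1 \<le> p x0" using x0 x1 closure_subset by blast
    ultimately show False using \<delta> by linarith
  qed
  then have x0S: "x0 \<in> S" using x0(1) S(1) by (simp add: frontier_def interior_open)
  let ?Du = "frechet_derivative (gradient u) (at x0)"
  let ?Dw = "frechet_derivative (gradient w) (at x0)"
  \<comment> \<open>Both Laplacians vanish, so only 2 \<epsilon> times the dimension remains; hence
    some basis direction \<open>e\<close> has a positive second derivative.\<close>
  have "(\<Sum>e\<in>Basis. ?Du e \<bullet> e - ?Dw e \<bullet> e + 2 * \<epsilon>) > 0"
    using u(1) w(1) x0S \<epsilon> by (simp add: harmonic_on_def laplacian_def sum.distrib sum_subtractf)
  then obtain e where e: "e \<in> (Basis::'a set)" "?Du e \<bullet> e - ?Dw e \<bullet> e + 2 * \<epsilon> > 0"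
    by (metis (no_types, lifting) linorder_not_less sum_nonpos)
  obtain d where d: "d > 0" "ball x0 d \<subseteq> S" using S(1) x0S open_contains_ball by blast
  have inS: "x0 + t *\<^sub>R e \<in> S" if "\<bar>t\<bar> < d" for t
    using that d e by (auto simp: dist_norm intro!: subsetD[OF d(2)])
  \<comment> \<open>\<open>q\<close> is the gradient of \<open>p\<close>; the last term comes from
    differentiating \<open>x \<bullet> x\<close>.\<close>
  define q where "q x = gradient u x - gradient w x + (2 * \<epsilon>) *\<^sub>R x" for x
  have dp: "(p has_derivative (\<lambda>h. h \<bullet> q x)) (at x)" if "x \<in> S" for x
  proof -
    have 1: "(u has_derivative (\<lambda>h. h \<bullet> gradient u x)) (at x)"
      "(w has_derivative (\<lambda>h. h \<bullet> gradient w x)) (at x)"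
      using GDERIV_gradient u(1) w(1) that
      unfolding gderiv_def harmonic_on_def C2_on_def by blast+
    show ?thesis
      unfolding p_def q_def
      by (rule derivative_eq_intros 1 refl)+ (auto simp: algebra_simps inner_commute)
  qed
  have dq: "(q has_derivative (\<lambda>h. ?Du h - ?Dw h + (2 * \<epsilon>) *\<^sub>R h)) (at x0)"
  proof -
    have 1: "(gradient u has_derivative ?Du) (at x0)" "(gradient w has_derivative ?Dw) (at x0)"
      using u(1) w(1) x0S frechet_derivative_works
      unfolding harmonic_on_def C2_on_def by blast+
    show ?thesis
      unfolding q_def by (rule derivative_eq_intros 1 refl)+ auto
  qed
  have line: "((\<lambda>t. x0 + t *\<^sub>R e) has_derivative (\<lambda>s. s *\<^sub>R e)) (at t)" for t
    by (auto intro!: derivative_eq_intros)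
  show False
  proof (rule not_local_max_of_deriv2_pos[OF d(1)])
    show "((\<lambda>t. p (x0 + t *\<^sub>R e)) has_real_derivative q (x0 + t *\<^sub>R e) \<bullet> e) (at t)"
      if "\<bar>t\<bar> < d" for t
      using has_derivative_compose[OF line dp[OF inS[OF that]]]
      by (simp add: has_field_derivative_def inner_commute mult_commute_abs)
    have "((\<lambda>t. q (x0 + t *\<^sub>R e)) has_derivative (\<lambda>s. ?Du (s *\<^sub>R e) - ?Dw (s *\<^sub>R e) + (2 * \<epsilon>) *\<^sub>R (s *\<^sub>R e))) (at 0)"
      using has_derivative_compose[OF line[of 0], of q
          "\<lambda>h. ?Du h - ?Dw h + (2 * \<epsilon>) *\<^sub>R h"] dq by simp
    note dqe = has_derivative_inner_left[OF this, of e]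
    show "((\<lambda>t. q (x0 + t *\<^sub>R e) \<bullet> e) has_real_derivative
        (?Du e \<bullet> e - ?Dw e \<bullet> e + 2 * \<epsilon>)) (at 0)"
    proof -
      have lin: "linear ?Du" "linear ?Dw"
        using u(1) w(1) x0S linear_frechet_derivative
        unfolding harmonic_on_def C2_on_def by blast+
      show ?thesis
        unfolding has_field_derivative_def
        by (rule has_derivative_eq_rhs[OF dqe]) (use e(1) in \<open>
          simp add: fun_eq_iff linear_scale[OF lin(1)] linear_scale[OF lin(2)]
            inner_diff_left inner_add_left algebra_simps\<close>)
    qed
    show "p (x0 + t *\<^sub>R e) \<le> p (x0 + 0 *\<^sub>R e)" if "\<bar>t\<bar> < d" for t
      using x0(2) inS[OF that] closure_subset by auto
  qed (use e in auto)
qed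

section \<open>Real parts of holomorphic functions as harmonic extensions\<close>

definition complex_of_vec :: "real ^ 2 \<Rightarrow> complex" where
  "complex_of_vec x = Complex (x $ 1) (x $ 2)"

definition vec_of_complex :: "complex \<Rightarrow> real ^ 2" where
  "vec_of_complex z = vector [Re z, Im z]"

lemma vec_of_complex_nth [simp]: "vec_of_complex z $ 1 = Re z" "vec_of_complex z $ 2 = Im z"
  by (simp_all add: vec_of_complex_def)

lemma complex_of_vec_simps [simp]: "Re (complex_of_vec x) = x $ 1" "Im (complex_of_vec x) = x $ 2"
  by (simp_all add: complex_of_vec_def)

lemma inner_real2: "x \<bullet> y = x $ 1 * y $ 1 + x $ 2 * y $ 2" for x y :: "real ^ 2"
  by (simp add: inner_vec_def sum_2)

lemma cmod_complex_of_vec [simp]: "cmod (complex_of_vec x) = norm x"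
  by (simp add: cmod_def norm_eq_sqrt_inner inner_real2 power2_eq_square)

text \<open>This is where conjugates enter: multiplication by w followed by \<open>Re\<close> is the
  real linear form represented by the conjugate of w. It serves both to read off gradients and to
  multiply two of them.\<close>

lemma inner_vec_of_complex: "h \<bullet> vec_of_complex (cnj w) = Re (w * complex_of_vec h)"
  by (simp add: inner_real2)

lemma bounded_linear_complex_of_vec: "bounded_linear complex_of_vec"
  by (intro linear_conv_bounded_linear[THEN iffD1] linearI) (auto simp: complex_eq_iff)

lemma bounded_linear_vec_of_complex: "bounded_linear vec_of_complex"
  by (intro linear_conv_bounded_linear[THEN iffD1] linearI) (auto simp: vec_eq_iff forall_2)

lemma Basis_real2: "(Basis :: (real ^ 2) set) = {axis 1 1, axis 2 1}"
  by (auto simp: Basis_vec_def UNIV_2)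

context
  fixes F F' F'' :: "complex \<Rightarrow> complex"
  assumes F: "\<And>z. (F has_field_derivative F' z) (at z)"
    and F': "\<And>z. (F' has_field_derivative F'' z) (at z)"
    and F'': "continuous_on UNIV F''"
begin

lemma GDERIV_Re_holomorphic:
  "GDERIV (\<lambda>x. Re (F (complex_of_vec x))) x :> vec_of_complex (cnj (F' (complex_of_vec x)))"
  unfolding gderiv_def inner_vec_of_complex
  by (intro has_derivative_Re has_derivative_compose[OF bounded_linear_imp_has_derivative
        [OF bounded_linear_complex_of_vec]] F[unfolded has_field_derivative_def])

lemma gradient_Re_holomorphic:
  "gradient (\<lambda>x. Re (F (complex_of_vec x))) = (\<lambda>x. vec_of_complex (cnj (F' (complex_of_vec x))))"
  using gradient_eqI[OF GDERIV_Re_holomorphic] by blast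

text \<open>The derivative of the gradient sends h to the conjugate of \<open>F''\<close> h. Its
  diagonal entries in the directions 1 and \<i> are Re \<open>F''\<close> and - Re
  \<open>F''\<close>, so the trace vanishes.\<close>

lemma harmonic_on_Re_holomorphic: "harmonic_on S (\<lambda>x. Re (F (complex_of_vec x)))"
proof -
  let ?u = "\<lambda>x. Re (F (complex_of_vec x))"
  have d: "(gradient ?u has_derivative
      (\<lambda>h. vec_of_complex (cnj (F'' (complex_of_vec x) * complex_of_vec h)))) (at x)" for x
    unfolding gradient_Re_holomorphic
    by (intro bounded_linear.has_derivative[OF bounded_linear_vec_of_complex] has_derivative_cnj
        has_derivative_compose[OF bounded_linear_imp_has_derivative
        [OF bounded_linear_complex_of_vec]] F'[unfolded has_field_derivative_def])
  have fd: "frechet_derivative (gradient ?u) (at x) =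
      (\<lambda>h. vec_of_complex (cnj (F'' (complex_of_vec x) * complex_of_vec h)))" for x
    using frechet_derivative_at[OF d] by simp
  have "laplacian ?u x = 0" for x
    unfolding laplacian_def fd Basis_real2
    by (simp add: axis_eq_axis inner_axis) (simp add: axis_def)
  moreover have "C2_on S ?u"
    unfolding C2_on_def fd
  proof (intro conjI allI ballI)
    fix x show "?u differentiable at x" "gradient ?u differentiable at x"
      using d GDERIV_Re_holomorphic unfolding differentiable_def gderiv_def by blast+
  next
    fix h show "continuous_on S (\<lambda>x. vec_of_complex (cnj (F'' (complex_of_vec x) * complex_of_vec h)))"
      by (intro bounded_linear.continuous_on[OF bounded_linear_vec_of_complex] continuous_intros
          continuous_on_compose2[OF F''] bounded_linear.continuous_on[OF bounded_linear_complex_of_vec]) auto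
  qed
  ultimately show ?thesis by (simp add: harmonic_on_def)
qed

text \<open>The explicit real part witnesses that a solution exists, so the chosen extension is a
  solution too. Comparing the two in both directions gives equality on the open disk, hence equal
  gradients there.\<close>

lemma gradient_harmonic_extension_Re:
  assumes f: "\<And>\<phi>. Re (F (cis \<phi>)) = f \<phi>" and x: "x \<in> unit_disk"
  shows "gradient (harmonic_extension f) x = vec_of_complex (cnj (F' (complex_of_vec x)))"
proof -
  let ?u = "\<lambda>x. Re (F (complex_of_vec x))"
  let ?v = "harmonic_extension f"
  have "continuous_on A F" for A
    by (intro continuous_at_imp_continuous_on ballI DERIV_isCont[OF F])
  from continuous_on_Re[OF continuous_on_compose2[OF this[of UNIV]
        linear_continuous_on[OF bounded_linear_complex_of_vec] subset_UNIV]]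
  have cont: "continuous_on A ?u" for A .
  have cis: "complex_of_vec (vector [cos \<phi>, sin \<phi>]) = cis \<phi>" for \<phi>
    by (simp add: complex_eq_iff)
  have u: "solves_dirichlet f ?u"
    unfolding solves_dirichlet_def using harmonic_on_Re_holomorphic cont f cis by auto
  then have v: "solves_dirichlet f ?v"
    unfolding harmonic_extension_def by (rule someI[of "solves_dirichlet f"])
  have bd: "?v y = ?u y" if "y \<in> frontier unit_disk" for y
  proof -
    have "cmod (complex_of_vec y) = 1" using that by simp
    then obtain \<phi> where "complex_of_vec y = cis \<phi>" by (metis complex_unimodular_polar cis.ctr complex_eq_iff complex.sel)
    then have "y = vector [cos \<phi>, sin \<phi>]" by (simp add: complex_eq_iff vec_eq_iff forall_2)
    then show ?thesis using u v by (metis solves_dirichlet_def)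
  qed
  have "?v y = ?u y" if y: "y \<in> unit_disk" for y
  proof (rule antisym)
    show "?v y \<le> ?u y"
      by (rule harmonic_on_le[OF _ _ _ _ _ _ _ y])
         (use u v bd in \<open>auto simp: solves_dirichlet_def\<close>)
    show "?u y \<le> ?v y"
      by (rule harmonic_on_le[OF _ _ _ _ _ _ _ y])
         (use u v bd in \<open>auto simp: solves_dirichlet_def\<close>)
  qed
  then show ?thesis
    using gradient_cong_open[OF open_ball x _ GDERIV_Re_holomorphic] by blast
qed

end

text \<open>The truncated exponents \<open>n - 1\<close> and \<open>n - 1 - 1\<close> are harmless:
  whenever one truncates, the coefficient in front of the power is zero.\<close>

lemma gradient_harmonic_extension_cos:
  assumes "x \<in> unit_disk"
  shows "gradient (harmonic_extension (\<lambda>\<phi>. cos (real n * \<phi>))) x =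
    vec_of_complex (cnj (of_nat n * complex_of_vec x ^ (n - 1)))"
  by (rule gradient_harmonic_extension_Re[where F = "\<lambda>z. z ^ n"
        and F'' = "\<lambda>z. of_nat n * (of_nat (n - 1) * z ^ (n - 1 - 1))", OF _ _ _ _ assms])
     (auto intro!: derivative_eq_intros continuous_intros simp: Complex.DeMoivre)

lemma gradient_harmonic_extension_sin:
  assumes "x \<in> unit_disk"
  shows "gradient (harmonic_extension (\<lambda>\<phi>. sin (real n * \<phi>))) x =
    vec_of_complex (cnj (- \<i> * (of_nat n * complex_of_vec x ^ (n - 1))))"
  by (rule gradient_harmonic_extension_Re[where F = "\<lambda>z. - \<i> * z ^ n"
        and F'' = "\<lambda>z. - \<i> * (of_nat n * (of_nat (n - 1) * z ^ (n - 1 - 1)))", OF _ _ _ _ assms])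
     (auto intro!: derivative_eq_intros continuous_intros simp: Complex.DeMoivre)

text \<open>The parameters \<alpha> and \<beta> treat all cases at once: 1 stands for a cosine and -
  \<i> for a sine. Then \<beta> times the conjugate of \<alpha> is 1 for equal types, leaving a
  cosine of the angle difference, and - \<i> for cosine against sine, leaving a sine.\<close>

lemma inner_gradients_polar:
  assumes "i \<ge> 1" "j \<ge> 1"
  shows "vec_of_complex (cnj (\<alpha> * (of_nat i * complex_of_vec x ^ (i - 1)))) \<bullet>
      vec_of_complex (cnj (\<beta> * (of_nat j * complex_of_vec x ^ (j - 1)))) =
    real i * real j * norm x ^ (i + j - 2) *
      Re (\<beta> * cnj \<alpha> * cis ((real j - real i) * polar_angle x))"
proof -
  let ?\<theta> = "polar_angle x"
  have z: "complex_of_vec x = rcis (norm x) ?\<theta>"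
    using rcis_cmod_Arg[of "complex_of_vec x"] by (simp add: polar_angle_def complex_of_vec_def[symmetric])
  have c: "complex_of_vec (vec_of_complex w) = w" for w by (simp add: complex_eq_iff)
  have "\<beta> * (of_nat j * complex_of_vec x ^ (j - 1)) * cnj (\<alpha> * (of_nat i * complex_of_vec x ^ (i - 1)))
    = of_real (real i * real j * (norm x ^ (j - 1) * norm x ^ (i - 1))) *
      (\<beta> * cnj \<alpha> * (cis (real (j - 1) * ?\<theta>) * cis (- (real (i - 1) * ?\<theta>))))"
    unfolding z by (simp add: rcis_def Complex.DeMoivre power_mult_distrib cis_cnj)
  also have "norm x ^ (j - 1) * norm x ^ (i - 1) = norm x ^ (i + j - 2)"
    using assms by (simp flip: power_add add: add.commute numeral_2_eq_2)
  also have "cis (real (j - 1) * ?\<theta>) * cis (- (real (i - 1) * ?\<theta>)) = cis ((real j - real i) * ?\<theta>)"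
    using assms by (simp add: cis_mult of_nat_diff algebra_simps)
  finally have "Re (\<beta> * (of_nat j * complex_of_vec x ^ (j - 1)) *
      cnj (\<alpha> * (of_nat i * complex_of_vec x ^ (i - 1)))) =
    Re (of_real (real i * real j * norm x ^ (i + j - 2)) *
      (\<beta> * cnj \<alpha> * cis ((real j - real i) * ?\<theta>)))"
    by (rule arg_cong)
  then show ?thesis
    unfolding inner_vec_of_complex c by (simp only: times_complex.sel Re_complex_of_real Im_complex_of_real mult_zero_left diff_zero)
qed

subsection \<open>Polar coordinates\<close>

text \<open>\<open>lborel\<close> is the image of the product measure indexed by
  \<open>Basis\<close> under the coordinate expansion, so the claim is the product rule transported
  along that map.\<close>

lemma lborel_product:
  fixes f :: "'a::euclidean_space \<Rightarrow> real \<Rightarrow> real"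
  assumes "\<And>b. b \<in> Basis \<Longrightarrow> integrable lborel (f b)"
  shows "integrable lborel (\<lambda>x. \<Prod>b\<in>Basis. f b (x \<bullet> b))"
    and "(LINT x|lborel. (\<Prod>b\<in>Basis. f b (x \<bullet> b))) = (\<Prod>b\<in>Basis. (LINT t|lborel. f b t))"
proof -
  interpret product_sigma_finite "\<lambda>_::'a. lborel :: real measure" ..
  let ?P = "Pi\<^sub>M Basis (\<lambda>_::'a. lborel :: real measure)"
  let ?F = "\<lambda>x. \<Prod>b\<in>Basis. f b (x \<bullet> b)"
  let ?h = "\<lambda>y. \<Sum>b\<in>Basis. y b *\<^sub>R (b::'a)"
  have D: "(lborel :: 'a measure) = distr ?P borel ?h"
    by (subst lborel_def) (simp add: lborel_eq_real)
  have h: "?h \<in> borel_measurable ?P" by measurable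
  have f: "f b \<in> borel_measurable borel" if "b \<in> Basis" for b
    using borel_measurable_integrable[OF assms[OF that]] by simp
  have F: "?F \<in> borel_measurable borel"
    by (intro borel_measurable_prod measurable_compose[OF _ f]) auto
  have eq: "?F (?h y) = (\<Prod>b\<in>Basis. f b (y b))" for y
    by (intro prod.cong) auto
  show "integrable lborel ?F"
    unfolding D integrable_distr_eq[OF h F] eq
    by (rule product_integrable_prod) (use assms in auto)
  show "integral\<^sup>L lborel ?F = (\<Prod>b\<in>Basis. (LINT t|lborel. f b t))"
    by (subst D, subst integral_distr[OF h F], unfold eq)
      (rule product_integral_prod, use assms in auto)
qed

text \<open>A cylinder over a null set is null. This lets almost-everywhere equalities of
  one-variable functions be used inside a product over coordinates.\<close>

lemma AE_lborel_coordinate: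
  assumes "AE t in lborel. P t" and b: "b \<in> (Basis :: 'a::euclidean_space set)"
  shows "AE x in lborel :: 'a measure. P (x \<bullet> b)"
proof -
  obtain N where N: "{t. \<not> P t} \<subseteq> N" "emeasure lborel N = 0" "N \<in> sets borel"
    using AE_E[OF assms(1)] by auto
  have M: "{x::'a. x \<bullet> b \<in> N} \<in> sets lborel"
    using measurable_sets[of "\<lambda>x::'a. x \<bullet> b" borel borel N] N(3) by (simp add: vimage_def)
  have "emeasure lborel {x::'a. x \<bullet> b \<in> N} =
      (\<integral>\<^sup>+x. indicator N ((x::'a) \<bullet> b) \<partial>lborel)"
    by (subst nn_integral_indicator[OF M, symmetric])
      (auto intro!: nn_integral_cong split: split_indicator)
  \<comment> \<open>The indicator of the cylinder is a product with factor 1 in every other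
    coordinate. Those factors have infinite integral, but zero times infinity is zero in
    \<open>ennreal\<close>.\<close>
  also have "\<dots> = (\<integral>\<^sup>+x. (\<Prod>c\<in>Basis. ennreal (if c = b then indicator N ((x::'a) \<bullet> c) else 1)) \<partial>lborel)"
    using b by (intro nn_integral_cong) (simp add: prod.If_cases if_distrib Int_absorb1 prod.delta ennreal_indicator cong: if_cong)
  also have "\<dots> = (\<Prod>c\<in>(Basis::'a set). \<integral>\<^sup>+t. ennreal (if c = b then indicator N t else 1) \<partial>lborel)"
    by (subst nn_integral_lborel_prod) (use N(3) in auto)
  also have "\<dots> = 0"
    using N b by (intro prod_zero) (auto intro!: bexI[of _ b] simp: ennreal_indicator)
  finally show ?thesis
    by (intro AE_I[where N = "{x. x \<bullet> b \<in> N}"]) (use N M in auto)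
qed

text \<open>Each factor is replaced by a Borel function equal to it almost everywhere. The product
  rule holds for these, and passing to the completion changes neither integrability nor
  integrals.\<close>

lemma lebesgue_product:
  fixes f :: "'a::euclidean_space \<Rightarrow> real \<Rightarrow> real"
  assumes f: "\<And>b. b \<in> Basis \<Longrightarrow> integrable lebesgue (f b)"
  shows "integrable lebesgue (\<lambda>x. \<Prod>b\<in>Basis. f b (x \<bullet> b))"
    and "(LINT x|lebesgue. (\<Prod>b\<in>Basis. f b (x \<bullet> b))) = (\<Prod>b\<in>Basis. (LINT t|lebesgue. f b t))"
proof -
  have "\<forall>b\<in>Basis. \<exists>g. g \<in> borel_measurable lborel \<and> (AE t in lborel. f b t = g t)"
    using completion_ex_borel_measurable_real borel_measurable_integrable f by blast
  then obtain g where g: "\<And>b. b \<in> Basis \<Longrightarrow> g b \<in> borel_measurable lborel"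
      "\<And>b. b \<in> Basis \<Longrightarrow> AE t in lborel. f b t = g b t"
    by metis
  have gint: "integrable lborel (g b)" "(LINT t|lborel. g b t) = (LINT t|lebesgue. f b t)"
    if b: "b \<in> Basis" for b
  proof -
    have gl: "g b \<in> borel_measurable lebesgue" using g(1)[OF b] by (rule measurable_completion)
    have ae: "AE t in lebesgue. f b t = g b t" using g(2)[OF b] by (rule AE_completion)
    have "integrable lebesgue (g b)"
      using f[OF b] integrable_cong_AE[OF _ gl ae] borel_measurable_integrable by blast
    then show "integrable lborel (g b)" using integrable_completion g(1)[OF b] by blast
    have "(LINT t|lborel. g b t) = (LINT t|lebesgue. g b t)"
      using integral_completion[OF g(1)[OF b]] by simp
    also have "\<dots> = (LINT t|lebesgue. f b t)"
      using integral_cong_AE[OF _ gl ae] borel_measurable_integrable[OF f[OF b]] by simp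
    finally show "(LINT t|lborel. g b t) = (LINT t|lebesgue. f b t)" .
  qed
  let ?F = "\<lambda>x. \<Prod>b\<in>Basis. f b (x \<bullet> b)" and ?G = "\<lambda>x. \<Prod>b\<in>Basis. g b (x \<bullet> b)"
  have "AE x in lborel. \<forall>b\<in>Basis. f b (x \<bullet> b) = g b (x \<bullet> b)"
    using AE_lborel_coordinate[OF g(2)] by (intro AE_finite_allI) auto
  then have "AE x in lborel. ?F x = ?G x"
    by eventually_elim (auto intro: prod.cong)
  then have ae: "AE x in lebesgue. ?G x = ?F x"
    by (intro AE_completion) (auto simp: eq_commute)
  have G: "integrable lborel ?G" "(LINT x|lborel. ?G x) = (\<Prod>b\<in>Basis. (LINT t|lborel. g b t))"
    using lborel_product[of g] gint(1) by blast+
  from G(1) have Gm: "?G \<in> borel_measurable lborel" by (rule borel_measurable_integrable)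
  then have Gl: "integrable lebesgue ?G" "(LINT x|lebesgue. ?G x) = (LINT x|lborel. ?G x)"
    using G(1) integrable_completion integral_completion by blast+
  note Gm' = borel_measurable_integrable[OF Gl(1)]
  note Fm = borel_measurable_AE[OF Gm' ae]
  show "integrable lebesgue ?F"
    by (rule integrable_cong_AE_imp[OF Gl(1) Fm ae])
  show "(LINT x|lebesgue. ?F x) = (\<Prod>b\<in>Basis. (LINT t|lebesgue. f b t))"
    unfolding integral_cong_AE[OF Gm' Fm ae, symmetric] Gl(2) G(2)
    by (rule prod.cong) (auto simp: gint(2))
qed

section \<open>Change of variables to polar coordinates\<close>

text \<open>A real function is regarded as a map into \<open>real^1\<close> to match the
  vector-valued theorem.\<close>

lemma has_absolute_integral_change_of_variables_real:
  fixes f :: "real^'m::{finite,wellorder} \<Rightarrow> real" and g :: "real^'m::_ \<Rightarrow> real^'m::_"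
  assumes "S \<in> sets lebesgue"
    and "\<And>x. x \<in> S \<Longrightarrow> (g has_derivative g' x) (at x within S)"
    and "inj_on g S"
  shows "(\<lambda>x. \<bar>det (matrix (g' x))\<bar> * f (g x)) absolutely_integrable_on S \<and>
           integral S (\<lambda>x. \<bar>det (matrix (g' x))\<bar> * f (g x)) = b
     \<longleftrightarrow> f absolutely_integrable_on (g ` S) \<and> integral (g ` S) f = b"
  using has_absolute_integral_change_of_variables[OF assms, of "\<lambda>x. vec (f x) :: real^1" "vec b"]
  by (simp add: absolutely_integrable_on_1_iff integral_on_1_eq)

lemma integrable_lebesgue_on_iff:
  fixes f :: "'a::euclidean_space \<Rightarrow> real"
  assumes "S \<in> sets lebesgue"
  shows "integrable (lebesgue_on S) f \<longleftrightarrow> f absolutely_integrable_on S"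
  using assms by (simp add: integrable_restrict_space set_integrable_def)

definition polar_map :: "real ^ 2 \<Rightarrow> real ^ 2" where
  "polar_map x = vector [x $ 1 * cos (x $ 2), x $ 1 * sin (x $ 2)]"

text \<open>\<open>Arg\<close> takes values in the interval from -pi, excluded, to pi, included.
  Dropping the angle pi and the radius 0 makes the box open and lets norm and
  \<open>polar_angle\<close> invert \<open>polar_map\<close> exactly.\<close>

definition polar_box :: "(real ^ 2) set" where
  "polar_box = {x. 0 < x $ 1 \<and> x $ 1 < 1 \<and> - pi < x $ 2 \<and> x $ 2 < pi}"

lemma polar_box_measurable: "polar_box \<in> sets lebesgue"
proof -
  have "open polar_box"
    unfolding polar_box_def by (intro open_Collect_conj open_Collect_less continuous_intros)
  then show ?thesis by simp
qed

lemma complex_of_vec_polar_map: "complex_of_vec (polar_map x) = rcis (x $ 1) (x $ 2)"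
  by (simp add: complex_eq_iff polar_map_def)

lemma norm_polar_map [simp]: "x \<in> polar_box \<Longrightarrow> norm (polar_map x) = x $ 1"
  by (simp flip: cmod_complex_of_vec add: complex_of_vec_polar_map polar_box_def)

lemma polar_angle_polar_map [simp]: "x \<in> polar_box \<Longrightarrow> polar_angle (polar_map x) = x $ 2"
  unfolding polar_angle_def complex_of_vec_def[symmetric] complex_of_vec_polar_map
  by (rule Arg_unique'[of "x $ 1"]) (auto simp: polar_box_def)

lemma inj_on_polar_map: "inj_on polar_map polar_box"
proof (rule inj_onI)
  fix x y assume "x \<in> polar_box" "y \<in> polar_box" "polar_map x = polar_map y"
  then have "x $ 1 = y $ 1" "x $ 2 = y $ 2"
    by (metis norm_polar_map, metis polar_angle_polar_map)
  then show "x = y" by (simp add: vec_eq_iff forall_2)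
qed

lemma has_derivative_polar_map:
  "(polar_map has_derivative (\<lambda>h. vector [h $ 1 * cos (x $ 2) - x $ 1 * sin (x $ 2) * h $ 2,
      h $ 1 * sin (x $ 2) + x $ 1 * cos (x $ 2) * h $ 2])) (at x within S)"
proof -
  have [simp]: "vector [a, b] = a *\<^sub>R axis 1 1 + b *\<^sub>R (axis 2 1 :: real ^ 2)" for a b
    by (simp add: vec_eq_iff forall_2 axis_def)
  have nth: "((\<lambda>x::real ^ 2. x $ k) has_derivative (\<lambda>h. h $ k)) (at x within S)" for k
    by (rule bounded_linear_imp_has_derivative[OF bounded_linear_vec_nth])
  show ?thesis
    unfolding polar_map_def[abs_def]
    by (simp, (rule derivative_eq_intros nth refl)+) (simp add: fun_eq_iff algebra_simps)
qed

lemma det_polar_map: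
  "det (matrix (\<lambda>h. vector [h $ 1 * cos (x $ 2) - x $ 1 * sin (x $ 2) * h $ 2,
      h $ 1 * sin (x $ 2) + x $ 1 * cos (x $ 2) * h $ 2] :: real ^ 2)) = x $ 1"
proof -
  have "x $ 1 * (cos (x $ 2))\<^sup>2 + x $ 1 * (sin (x $ 2))\<^sup>2 = x $ 1"
    by (simp flip: distrib_left)
  then show ?thesis
    by (simp add: det_2 matrix_def axis_def power2_eq_square algebra_simps)
qed

text \<open>The points missed are the origin and those with argument pi; all lie on the horizontal
  axis, a hyperplane.\<close>

lemma negligible_unit_disk_diff_polar: "negligible (unit_disk - polar_map ` polar_box)"
proof (rule negligible_subset)
  show "negligible {x :: real ^ 2. axis 2 1 \<bullet> x = 0}"
    by (rule negligible_hyperplane) simp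
  show "unit_disk - polar_map ` polar_box \<subseteq> {x. axis 2 1 \<bullet> x = 0}"
  proof
    fix x assume x: "x \<in> unit_disk - polar_map ` polar_box"
    let ?y = "vector [norm x, polar_angle x] :: real ^ 2"
    have "complex_of_vec (polar_map ?y) = complex_of_vec x"
      using rcis_cmod_Arg[of "complex_of_vec x"]
      by (simp add: complex_of_vec_polar_map polar_angle_def complex_of_vec_def[symmetric])
    then have "polar_map ?y = x"
      by (simp add: complex_eq_iff vec_eq_iff forall_2)
    then have "?y \<notin> polar_box" using x by force
    then have "x = 0 \<or> polar_angle x = pi"
      using x Arg_bounded[of "complex_of_vec x"]
      by (auto simp: polar_box_def polar_angle_def complex_of_vec_def[symmetric])
    then have "x $ 2 = 0"
      using Arg_eq_pi[of "complex_of_vec x"] by (auto simp: polar_angle_def complex_of_vec_def[symmetric])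
    then show "x \<in> {x. axis 2 1 \<bullet> x = 0}" by (simp add: inner_axis')
  qed
qed

lemma polar_map_subset: "polar_map ` polar_box \<subseteq> unit_disk"
  by (auto simp: polar_box_def)

text \<open>Integrability is assumed on the box, where products separate, and transferred to the
  disk. The image of the box differs from the disk only by a null set.\<close>

lemma polar_coordinates:
  fixes F :: "real ^ 2 \<Rightarrow> real"
  assumes "integrable (lebesgue_on polar_box) (\<lambda>x. x $ 1 * F (polar_map x))"
  shows "integrable (lebesgue_on unit_disk) F"
    and "(LINT x|lebesgue_on unit_disk. F x) =
      (LINT x|lebesgue_on polar_box. x $ 1 * F (polar_map x))"
proof -
  let ?d = "\<lambda>x. \<bar>det (matrix (\<lambda>h. vector [h $ 1 * cos (x $ 2) - x $ 1 * sin (x $ 2) * h $ 2,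
      h $ 1 * sin (x $ 2) + x $ 1 * cos (x $ 2) * h $ 2] :: real ^ 2))\<bar> * F (polar_map x)"
  have d: "?d x = x $ 1 * F (polar_map x)" if "x \<in> polar_box" for x
    using that unfolding det_polar_map by (simp add: polar_box_def)
  have "?d absolutely_integrable_on polar_box \<and> integral polar_box ?d = integral polar_box ?d
     \<longleftrightarrow> F absolutely_integrable_on (polar_map ` polar_box) \<and>
       integral (polar_map ` polar_box) F = integral polar_box ?d"
    by (rule has_absolute_integral_change_of_variables_real[OF polar_box_measurable
          has_derivative_polar_map inj_on_polar_map])
  moreover have "?d absolutely_integrable_on polar_box"
    using assms unfolding integrable_lebesgue_on_iff[OF polar_box_measurable]
    by (rule absolutely_integrable_spike[of _ _ "{}"]) (auto simp only: d negligible_empty)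
  ultimately have F: "F absolutely_integrable_on (polar_map ` polar_box)"
     "integral (polar_map ` polar_box) F = integral polar_box ?d" by auto
  have neg: "negligible {x \<in> polar_map ` polar_box - unit_disk. F x \<noteq> 0}"
    "negligible {x \<in> unit_disk - polar_map ` polar_box. F x \<noteq> 0}"
    using polar_map_subset
    by (blast intro: empty_imp_negligible negligible_subset[OF negligible_unit_disk_diff_polar])+
  have sp: "F absolutely_integrable_on (polar_map ` polar_box) \<longleftrightarrow> F absolutely_integrable_on unit_disk"
    using neg by (rule absolutely_integrable_spike_set_eq)
  show int: "integrable (lebesgue_on unit_disk) F"
    using F sp by (simp add: integrable_lebesgue_on_iff)
  have "(LINT x|lebesgue_on unit_disk. F x) = integral unit_disk F"
    using int by (rule lebesgue_integral_eq_integral) simp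
  also have "\<dots> = integral (polar_map ` polar_box) F"
    using neg by (rule integral_spike_set[symmetric])
  also have "\<dots> = integral polar_box (\<lambda>x. x $ 1 * F (polar_map x))"
    unfolding F(2) by (rule integral_cong) (rule d)
  also have "\<dots> = (LINT x|lebesgue_on polar_box. x $ 1 * F (polar_map x))"
    using assms polar_box_measurable by (rule lebesgue_integral_eq_integral[symmetric])
  finally show "(LINT x|lebesgue_on unit_disk. F x) =
      (LINT x|lebesgue_on polar_box. x $ 1 * F (polar_map x))" .
qed

text \<open>The Jacobian joins the radial factor. Extended by zero, the two factors multiply to the
  integrand cut off to the box, because the indicator of a box is itself a product.\<close>

lemma polar_coordinates_product:
  fixes c t :: "real \<Rightarrow> real"
  assumes c: "integrable (lebesgue_on {0<..<1}) (\<lambda>r. r * c r)"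
    and t: "integrable (lebesgue_on {-pi<..<pi}) t"
  shows "integrable (lebesgue_on unit_disk) (\<lambda>x. c (norm x) * t (polar_angle x))"
    and "(LINT x|lebesgue_on unit_disk. c (norm x) * t (polar_angle x)) =
      (LINT r|lebesgue_on {0<..<1}. r * c r) * (LINT \<phi>|lebesgue_on {-pi<..<pi}. t \<phi>)"
proof -
  define f where "f r = indicator {0<..<1} r * (r * c r)" for r
  define g where "g r = indicator {-pi<..<pi} r * t r" for r
  \<comment> \<open>The product rule is indexed by basis vectors, so \<open>k\<close> assigns the
    radial factor to the first axis and the angular factor to the second.\<close>
  define k where "k b = (if b = axis 1 1 then f else g)" for b :: "real ^ 2"
  have f: "integrable lebesgue f" "(LINT r|lebesgue. f r) = (LINT r|lebesgue_on {0<..<1}. r * c r)"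
    using c by (simp_all add: f_def[abs_def] integrable_restrict_space integral_restrict_space)
  have g: "integrable lebesgue g" "(LINT r|lebesgue. g r) = (LINT \<phi>|lebesgue_on {-pi<..<pi}. t \<phi>)"
    using t by (simp_all add: g_def[abs_def] integrable_restrict_space integral_restrict_space)
  have k: "integrable lebesgue (k b)" for b using f g by (simp add: k_def)
  have ax: "axis 1 1 \<noteq> (axis 2 1 :: real ^ 2)" by (simp add: axis_eq_axis)
  have P: "(\<Prod>b\<in>Basis. k b (x \<bullet> b)) = f (x $ 1) * g (x $ 2)" for x :: "real ^ 2"
    using ax by (simp add: Basis_real2 k_def inner_axis)
  have L: "(\<Prod>b\<in>Basis. (LINT t|lebesgue. k b t)) = integral\<^sup>L lebesgue f * integral\<^sup>L lebesgue g"
    using ax by (simp add: Basis_real2 k_def)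
  let ?F = "\<lambda>x. c (norm x) * t (polar_angle x)"
  have eq: "f (x $ 1) * g (x $ 2) = indicator polar_box x *\<^sub>R (x $ 1 * ?F (polar_map x))" for x
    by (cases "x \<in> polar_box") (auto simp: f_def g_def polar_box_def indicator_def)
  have "integrable (lebesgue_on polar_box) (\<lambda>x. x $ 1 * ?F (polar_map x))"
    using lebesgue_product(1)[of k] k polar_box_measurable unfolding P eq
    by (subst integrable_restrict_space) auto
  note pc = polar_coordinates[OF this]
  show "integrable (lebesgue_on unit_disk) ?F" by (rule pc)
  have "(LINT x|lebesgue_on unit_disk. ?F x) = (LINT x::real^2|lebesgue. f (x $ 1) * g (x $ 2))"
    unfolding pc(2) eq using polar_box_measurable by (subst integral_restrict_space) simp_all
  also have "\<dots> = integral\<^sup>L lebesgue f * integral\<^sup>L lebesgue g"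
    using lebesgue_product(2)[of k] k unfolding P L by blast
  finally show "(LINT x|lebesgue_on unit_disk. ?F x) =
      (LINT r|lebesgue_on {0<..<1}. r * c r) * (LINT \<phi>|lebesgue_on {-pi<..<pi}. t \<phi>)"
    unfolding f(2) g(2) .
qed

subsection \<open>Integration of the Fourier series\<close>

text \<open>On a finite measure space, Cauchy-Schwarz against the constant 1 turns L2 convergence
  into L1 convergence, and a weight bounded by 1 preserves it. The estimate uses extended integrals,
  the form in which the L2 distance is given.\<close>

lemma tendsto_integral_mult_L2:
  fixes u :: "nat \<Rightarrow> 'a \<Rightarrow> real"
  assumes "finite_measure M"
    and f: "f \<in> borel_measurable M" "integrable M (\<lambda>x. (f x)\<^sup>2)"
    and u: "\<And>n. u n \<in> borel_measurable M" "\<And>n. integrable M (\<lambda>x. u n x * h x)"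
    and h: "h \<in> borel_measurable M" "\<And>x. x \<in> space M \<Longrightarrow> \<bar>h x\<bar> \<le> 1"
    and lim: "(\<lambda>n. \<integral>\<^sup>+x. ennreal ((f x - u n x)\<^sup>2) \<partial>M) \<longlonglongrightarrow> 0"
  shows "(\<lambda>n. LINT x|M. u n x * h x) \<longlonglongrightarrow> (LINT x|M. f x * h x)"
proof (rule tendsto_L1_int)
  interpret finite_measure M by fact
  have [measurable]: "f \<in> borel_measurable M" "u n \<in> borel_measurable M" "h \<in> borel_measurable M" for n
    by (fact f u h)+
  show "integrable M (\<lambda>x. u n x * h x)" for n by (fact u)
  have "integrable M f" by (rule square_integrable_imp_integrable[OF f])
  then show "integrable M (\<lambda>x. f x * h x)"
  proof (rule Bochner_Integration.integrable_bound)
    show "AE x in M. norm (f x * h x) \<le> norm (f x)"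
      using h(2) by (intro AE_I2) (simp add: abs_mult mult_left_le)
  qed measurable
  let ?\<mu> = "emeasure M (space M)"
  have sq: "(\<integral>\<^sup>+x. ennreal (norm (u n x * h x - f x * h x)) \<partial>M)\<^sup>2 \<le>
      ?\<mu> * (\<integral>\<^sup>+x. ennreal ((f x - u n x)\<^sup>2) \<partial>M)" for n
  proof -
    have "(\<integral>\<^sup>+x. ennreal (norm (u n x * h x - f x * h x)) \<partial>M) \<le> (\<integral>\<^sup>+x. ennreal \<bar>f x - u n x\<bar> * 1 \<partial>M)"
    proof (rule nn_integral_mono)
      fix x assume "x \<in> space M"
      have "norm (u n x * h x - f x * h x) = \<bar>f x - u n x\<bar> * \<bar>h x\<bar>"
        by (simp add: abs_mult abs_minus_commute flip: left_diff_distrib)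
      also have "\<dots> \<le> \<bar>f x - u n x\<bar>"
        using h(2)[OF \<open>x \<in> space M\<close>] by (simp add: mult_left_le)
      finally show "ennreal (norm (u n x * h x - f x * h x)) \<le> ennreal \<bar>f x - u n x\<bar> * 1"
        by (simp add: ennreal_leI)
    qed
    then have "(\<integral>\<^sup>+x. ennreal (norm (u n x * h x - f x * h x)) \<partial>M)\<^sup>2 \<le> (\<integral>\<^sup>+x. ennreal \<bar>f x - u n x\<bar> * 1 \<partial>M)\<^sup>2"
      by (intro power_mono) auto
    also have "\<dots> \<le> (\<integral>\<^sup>+x. (ennreal \<bar>f x - u n x\<bar>)\<^sup>2 \<partial>M) * (\<integral>\<^sup>+x. 1\<^sup>2 \<partial>M)"
      by (rule Cauchy_Schwarz_nn_integral) measurable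
    finally show ?thesis by (simp add: ennreal_power mult.commute)
  qed
  have "(\<lambda>n. ?\<mu> * (\<integral>\<^sup>+x. ennreal ((f x - u n x)\<^sup>2) \<partial>M)) \<longlonglongrightarrow> ?\<mu> * 0"
    by (rule ennreal_tendsto_cmult[OF _ lim]) (simp add: less_top[symmetric])
  then have lim': "(\<lambda>n. ?\<mu> * (\<integral>\<^sup>+x. ennreal ((f x - u n x)\<^sup>2) \<partial>M)) \<longlonglongrightarrow> 0" by simp
  show "(\<lambda>n. \<integral>\<^sup>+x. ennreal (norm (u n x * h x - f x * h x)) \<partial>M) \<longlonglongrightarrow> 0"
  proof (rule order_tendstoI)
    fix e :: ennreal assume "e > 0"
    \<comment> \<open>Only the square of the L1 distance is estimated, so the threshold is squared
      too; monotonicity of squaring then recovers the bound by \<open>e\<close>.\<close>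
    then have "e\<^sup>2 > 0" by (simp add: power2_eq_square ennreal_zero_less_mult_iff)
    from order_tendstoD(2)[OF lim' this]
    show "\<forall>\<^sub>F n in sequentially. (\<integral>\<^sup>+x. ennreal (norm (u n x * h x - f x * h x)) \<partial>M) < e"
    proof eventually_elim
      case (elim n)
      show ?case
      proof (rule ccontr)
        assume "\<not> ?thesis"
        then have "e\<^sup>2 \<le> (\<integral>\<^sup>+x. ennreal (norm (u n x * h x - f x * h x)) \<partial>M)\<^sup>2"
          by (intro power_mono) auto
        with sq[of n] elim show False by (meson leD order.trans)
      qed
    qed
  qed simp
qed

section \<open>Orthogonality of the trigonometric system\<close>

abbreviation angles :: "real measure" where
  "angles \<equiv> lebesgue_on {-pi<..<pi}"

lemma integral_angles:
  fixes t :: "real \<Rightarrow> real"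
  assumes "continuous_on UNIV t"
  shows "integrable angles t" "(LINT \<phi>|angles. t \<phi>) = integral {-pi..pi} t"
proof -
  have "t absolutely_integrable_on {-pi..pi}"
    using assms continuous_on_subset by (blast intro: absolutely_integrable_continuous_real)
  then show i: "integrable angles t"
    using absolutely_integrable_on_open_interval[where f = t and a = "- pi" and b = pi] by (simp add: integrable_lebesgue_on_iff)
  show "(LINT \<phi>|angles. t \<phi>) = integral {-pi..pi} t"
    unfolding integral_open_interval_real by (rule lebesgue_integral_eq_integral[OF i]) simp
qed

lemma LINT_angles_cos: "(LINT \<phi>|angles. cos (of_int k * \<phi>)) = (if k = 0 then 2 * pi else 0)"
proof (cases "k = 0")
  case True
  then show ?thesis by (subst integral_angles(2)) (auto intro!: continuous_intros)
next
  case False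
  have "((\<lambda>\<phi>. cos (of_int k * \<phi>)) has_integral
      sin (of_int k * pi) / of_int k - sin (of_int k * - pi) / of_int k) {-pi..pi}"
    by (rule fundamental_theorem_of_calculus)
      (use False in \<open>auto intro!: derivative_eq_intros simp flip: has_real_derivative_iff_has_vector_derivative\<close>)
  then have "integral {-pi..pi} (\<lambda>\<phi>. cos (of_int k * \<phi>)) = 0"
    by (simp add: integral_unique sin_zero_iff_int2)
  then show ?thesis
    using False by (subst integral_angles(2)) (auto intro!: continuous_intros)
qed

lemma LINT_angles_sin: "(LINT \<phi>|angles. sin (c * \<phi>)) = 0"
proof (cases "c = 0")
  case False
  have "((\<lambda>\<phi>. sin (c * \<phi>)) has_integral - (cos (c * pi) / c) - - (cos (c * - pi) / c)) {-pi..pi}"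
    by (rule fundamental_theorem_of_calculus)
      (use False in \<open>auto intro!: derivative_eq_intros simp flip: has_real_derivative_iff_has_vector_derivative\<close>)
  then have "integral {-pi..pi} (\<lambda>\<phi>. sin (c * \<phi>)) = 0"
    by (simp add: integral_unique)
  then show ?thesis
    by (subst integral_angles(2)) (auto intro!: continuous_intros)
qed simp

text \<open>Product-to-sum reduces to integer frequencies n - m and n + m, of which only frequency 0
  contributes. Both are 0 when n = m = 0, which accounts for the doubled value.\<close>

lemma LINT_angles_cos_cos:
  "(LINT \<phi>|angles. cos (real n * \<phi>) * cos (real m * \<phi>)) =
    (if n = m then if m = 0 then 2 * pi else pi else 0)"
proof -
  have "(LINT \<phi>|angles. cos (real n * \<phi>) * cos (real m * \<phi>)) =
    (LINT \<phi>|angles. (cos (of_int (int n - int m) * \<phi>) + cos (of_int (int n + int m) * \<phi>)) / 2)"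
    unfolding cos_times_cos by (simp add: algebra_simps)
  also have "\<dots> = ((LINT \<phi>|angles. cos (of_int (int n - int m) * \<phi>)) +
      (LINT \<phi>|angles. cos (of_int (int n + int m) * \<phi>))) / 2"
    by (subst integral_divide_zero, subst Bochner_Integration.integral_add)
      (auto intro!: integral_angles continuous_intros)
  finally show ?thesis unfolding LINT_angles_cos by auto
qed

text \<open>For \<open>m \<ge> 1\<close> the frequency n + m is nonzero. At n = m = 0 the two
  contributions would cancel and give 0 instead of pi.\<close>

lemma LINT_angles_sin_sin:
  assumes "m \<ge> 1"
  shows "(LINT \<phi>|angles. sin (real n * \<phi>) * sin (real m * \<phi>)) = (if n = m then pi else 0)"
proof -
  have "(LINT \<phi>|angles. sin (real n * \<phi>) * sin (real m * \<phi>)) =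
    (LINT \<phi>|angles. (cos (of_int (int n - int m) * \<phi>) - cos (of_int (int n + int m) * \<phi>)) / 2)"
    unfolding sin_times_sin by (simp add: algebra_simps)
  also have "\<dots> = ((LINT \<phi>|angles. cos (of_int (int n - int m) * \<phi>)) -
      (LINT \<phi>|angles. cos (of_int (int n + int m) * \<phi>))) / 2"
    by (subst integral_divide_zero, subst Bochner_Integration.integral_diff)
      (auto intro!: integral_angles continuous_intros)
  finally show ?thesis using assms unfolding LINT_angles_cos by auto
qed

lemma LINT_angles_sin_cos:
  "(LINT \<phi>|angles. sin (real n * \<phi>) * cos (real m * \<phi>)) = 0"
proof -
  have "(LINT \<phi>|angles. sin (real n * \<phi>) * cos (real m * \<phi>)) =
    (LINT \<phi>|angles. (sin ((real n + real m) * \<phi>) + sin ((real n - real m) * \<phi>)) / 2)"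
    unfolding sin_times_cos by (simp add: algebra_simps)
  also have "\<dots> = ((LINT \<phi>|angles. sin ((real n + real m) * \<phi>)) +
      (LINT \<phi>|angles. sin ((real n - real m) * \<phi>))) / 2"
    by (subst integral_divide_zero, subst Bochner_Integration.integral_add)
      (auto intro!: integral_angles continuous_intros)
  finally show ?thesis by (simp add: LINT_angles_sin)
qed

section \<open>Radial moments and term-by-term integration\<close>

lemma finite_measure_unit_interval: "finite_measure (lebesgue_on {0<..<1::real})"
  by (rule finite_measure_lebesgue_on) simp

text \<open>On the unit interval the integrand is at most r |a|, which is bounded by r (a^2 + 1) and
  so by the integrable function a^2 r + 1.\<close>

lemma integrable_radial_moment:
  fixes a :: "real \<Rightarrow> real"
  assumes meas: "a \<in> borel_measurable (lebesgue_on {0<..<1})"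
    and fin: "(\<integral>\<^sup>+r. ennreal ((a r)\<^sup>2 * r) \<partial>lebesgue_on {0<..<1}) < \<infinity>"
  shows "integrable (lebesgue_on {0<..<1}) (\<lambda>r. r * (a r * r ^ k))"
proof -
  let ?I = "lebesgue_on {0<..<1::real}"
  interpret finite_measure ?I by (rule finite_measure_unit_interval)
  note [measurable] = meas
  have [measurable]: "(\<lambda>r. r) \<in> borel_measurable ?I"
    by (simp add: borel_measurable_if_D measurable_completion measurable_restrict_space1)
  have "integrable ?I (\<lambda>r. (a r)\<^sup>2 * r)"
  proof (rule integrableI_bounded)
    have "(\<integral>\<^sup>+r. ennreal (norm ((a r)\<^sup>2 * r)) \<partial>?I) = (\<integral>\<^sup>+r. ennreal ((a r)\<^sup>2 * r) \<partial>?I)"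
      by (rule nn_integral_cong) (simp add: space_restrict_space)
    then show "(\<integral>\<^sup>+r. ennreal (norm ((a r)\<^sup>2 * r)) \<partial>?I) < \<infinity>" using fin by simp
  qed measurable
  then have "integrable ?I (\<lambda>r. (a r)\<^sup>2 * r + 1)" by simp
  then show ?thesis
  proof (rule Bochner_Integration.integrable_bound)
    show "AE r in ?I. norm (r * (a r * r ^ k)) \<le> norm ((a r)\<^sup>2 * r + 1)"
    proof (rule AE_I2)
      fix r :: real assume "r \<in> space ?I"
      then have r: "0 < r" "r < 1" by (auto simp: space_restrict_space)
      have "r * \<bar>a r\<bar> * r ^ k \<le> r * \<bar>a r\<bar>"
        using r by (intro mult_left_le power_le_one) auto
      also have "\<dots> \<le> r * ((a r)\<^sup>2 + 1)"
      proof (rule mult_left_mono)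
        \<comment> \<open>Completing the square: expanding gives |a| \<le> a^2 + 1/4.\<close>
        have "0 \<le> (\<bar>a r\<bar> - 1 / 2)\<^sup>2" by simp
        then show "\<bar>a r\<bar> \<le> (a r)\<^sup>2 + 1" by (simp add: power2_eq_square algebra_simps)
      qed (use r in simp)
      also have "\<dots> \<le> (a r)\<^sup>2 * r + 1" using r by (simp add: algebra_simps)
      finally show "norm (r * (a r * r ^ k)) \<le> norm ((a r)\<^sup>2 * r + 1)"
        using r by (simp add: abs_mult mult_ac)
    qed
  qed measurable
qed

context
  fixes a b :: "nat \<Rightarrow> real \<Rightarrow> real" and k :: nat and \<tau> :: "real \<Rightarrow> real"
  assumes a: "\<And>n. integrable (lebesgue_on {0<..<1}) (\<lambda>r. r * (a n r * r ^ k))"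
    and b: "\<And>n. integrable (lebesgue_on {0<..<1}) (\<lambda>r. r * (b n r * r ^ k))"
    and \<tau>: "continuous_on UNIV \<tau>"
begin

text \<open>Each summand splits into a radial and an angular factor. The weight \<tau> is kept
  arbitrary to serve the cosine and sine weights as well as the constant 1.\<close>

lemma fourier_partial_sum_moment:
  "integrable (lebesgue_on unit_disk)
    (\<lambda>x. fourier_partial_sum a b N (norm x) (polar_angle x) * (norm x ^ k * \<tau> (polar_angle x)))" (is ?int)
  "(LINT x|lebesgue_on unit_disk.
      fourier_partial_sum a b N (norm x) (polar_angle x) * (norm x ^ k * \<tau> (polar_angle x))) =
    (LINT r|lebesgue_on {0<..<1}. r * (a 0 r * r ^ k)) * (LINT \<phi>|angles. \<tau> \<phi>) +
    (\<Sum>n=1..N. (LINT r|lebesgue_on {0<..<1}. r * (a n r * r ^ k)) * (LINT \<phi>|angles. cos (real n * \<phi>) * \<tau> \<phi>) +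
      (LINT r|lebesgue_on {0<..<1}. r * (b n r * r ^ k)) * (LINT \<phi>|angles. sin (real n * \<phi>) * \<tau> \<phi>))" (is ?eq)
proof -
  define A where "A n x = a n (norm x) * norm x ^ k * (cos (real n * polar_angle x) * \<tau> (polar_angle x))"
    for n and x :: "real ^ 2"
  define B where "B n x = b n (norm x) * norm x ^ k * (sin (real n * polar_angle x) * \<tau> (polar_angle x))"
    for n and x :: "real ^ 2"
  \<comment> \<open>The constant term is \<open>A 0\<close> because cos 0 = 1.\<close>
  have eq: "fourier_partial_sum a b N (norm x) (polar_angle x) * (norm x ^ k * \<tau> (polar_angle x)) =
      A 0 x + (\<Sum>n=1..N. A n x + B n x)" for x
    unfolding fourier_partial_sum_def A_def B_def distrib_right sum_distrib_right
    by (intro arg_cong2[where f = "(+)"] sum.cong) (simp_all add: mult_ac)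
  have c: "integrable angles (\<lambda>\<phi>. cos (real n * \<phi>) * \<tau> \<phi>)" "integrable angles (\<lambda>\<phi>. sin (real n * \<phi>) * \<tau> \<phi>)" for n
    by (intro integral_angles continuous_intros \<tau>)+
  have A: "integrable (lebesgue_on unit_disk) (A n)"
    "(LINT x|lebesgue_on unit_disk. A n x) =
      (LINT r|lebesgue_on {0<..<1}. r * (a n r * r ^ k)) * (LINT \<phi>|angles. cos (real n * \<phi>) * \<tau> \<phi>)" for n
    unfolding A_def using polar_coordinates_product[OF a c(1)] by blast+
  have B: "integrable (lebesgue_on unit_disk) (B n)"
    "(LINT x|lebesgue_on unit_disk. B n x) =
      (LINT r|lebesgue_on {0<..<1}. r * (b n r * r ^ k)) * (LINT \<phi>|angles. sin (real n * \<phi>) * \<tau> \<phi>)"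
    for n
    unfolding B_def using polar_coordinates_product[OF b c(2)] by blast+
  have AB: "integrable (lebesgue_on unit_disk) (\<lambda>x. \<Sum>n=1..N. A n x + B n x)"
    by (intro Bochner_Integration.integrable_sum Bochner_Integration.integrable_add A B)
  then show ?int
    unfolding eq by (rule Bochner_Integration.integrable_add[OF A(1)])
  have "(LINT x|lebesgue_on unit_disk. A 0 x + (\<Sum>n=1..N. A n x + B n x)) =
      (LINT x|lebesgue_on unit_disk. A 0 x) + (\<Sum>n=1..N. LINT x|lebesgue_on unit_disk. A n x + B n x)"
    unfolding Bochner_Integration.integral_add[OF A(1) AB]
    by (subst Bochner_Integration.integral_sum) (auto intro!: Bochner_Integration.integrable_add A B)
  also have "(\<Sum>n=1..N. LINT x|lebesgue_on unit_disk. A n x + B n x) =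
      (\<Sum>n=1..N. (LINT x|lebesgue_on unit_disk. A n x) + (LINT x|lebesgue_on unit_disk. B n x))"
    by (intro sum.cong Bochner_Integration.integral_add A B) auto
  finally show ?eq
    unfolding eq A(2) using B(2) by simp
qed

end

context
  fixes \<gamma> :: "real ^ 2 \<Rightarrow> real" and a b :: "nat \<Rightarrow> real \<Rightarrow> real"
  assumes L2: "L2_on unit_disk \<gamma>"
    and exp: "has_angular_fourier_expansion \<gamma> a b"
    and a_fin: "\<And>n. (\<integral>\<^sup>+r. ennreal ((a n r)\<^sup>2 * r) \<partial>lebesgue_on {0<..<1}) < \<infinity>"
    and b_fin: "\<And>n. (\<integral>\<^sup>+r. ennreal ((b n r)\<^sup>2 * r) \<partial>lebesgue_on {0<..<1}) < \<infinity>"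
begin

lemma radial_moments:
  "integrable (lebesgue_on {0<..<1}) (\<lambda>r. r * (a n r * r ^ k))"
  "integrable (lebesgue_on {0<..<1}) (\<lambda>r. r * (b n r * r ^ k))"
  using exp a_fin b_fin
  by (auto intro!: integrable_radial_moment simp: has_angular_fourier_expansion_def)

text \<open>The integrals of the partial sums converge to that of \<gamma>. If they equal
  \<open>c\<close> from some index on, uniqueness of limits gives the value, and no infinite series
  of integrals has to be summed.\<close>

lemma LINT_expansion:
  assumes \<tau>: "continuous_on UNIV \<tau>" "\<And>\<phi>. \<bar>\<tau> \<phi>\<bar> \<le> 1"
    and const: "\<And>N. N \<ge> m \<Longrightarrow> (LINT x|lebesgue_on unit_disk.
      fourier_partial_sum a b N (norm x) (polar_angle x) * (norm x ^ k * \<tau> (polar_angle x))) = c"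
  shows "(LINT x|lebesgue_on unit_disk. \<gamma> x * (norm x ^ k * \<tau> (polar_angle x))) = c"
proof (rule LIMSEQ_unique)
  show "(\<lambda>N. LINT x|lebesgue_on unit_disk.
      fourier_partial_sum a b N (norm x) (polar_angle x) * (norm x ^ k * \<tau> (polar_angle x)))
    \<longlonglongrightarrow> (LINT x|lebesgue_on unit_disk. \<gamma> x * (norm x ^ k * \<tau> (polar_angle x)))"
  proof (rule tendsto_integral_mult_L2)
    show "finite_measure (lebesgue_on unit_disk)"
      by (rule finite_measure_lebesgue_on) simp
    show "(\<lambda>x. fourier_partial_sum a b N (norm x) (polar_angle x)) \<in> borel_measurable (lebesgue_on unit_disk)" for N
      \<comment> \<open>Integrability with \<open>k = 0\<close> and constant weight 1 is
        integrability of the partial sum itself, which supplies its measurability.\<close>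
      using fourier_partial_sum_moment(1)[where a = a and b = b and k = 0 and \<tau> = "\<lambda>_. 1" and N = N] radial_moments[of _ 0]
      by (auto dest!: borel_measurable_integrable)
    show "integrable (lebesgue_on unit_disk)
      (\<lambda>x. fourier_partial_sum a b N (norm x) (polar_angle x) * (norm x ^ k * \<tau> (polar_angle x)))" for N
      using fourier_partial_sum_moment(1) radial_moments \<tau>(1) by blast
    \<comment> \<open>Integrability of the weight over the disk is obtained in polar coordinates in
      order to extract its measurability, as \<open>polar_angle\<close> is discontinuous along the
      slit.\<close>
    have "continuous_on {0..1} (\<lambda>r::real. r * r ^ k)" by (intro continuous_intros)
    then have "integrable (lebesgue_on {0<..<1}) (\<lambda>r::real. r * r ^ k)"
      using absolutely_integrable_on_open_interval[where f = "\<lambda>r::real. r * r ^ k" and a = 0 and b = 1]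
      by (simp add: integrable_lebesgue_on_iff absolutely_integrable_continuous_real)
    from polar_coordinates_product(1)[OF this integral_angles(1)[OF \<tau>(1)]]
    show "(\<lambda>x. norm x ^ k * \<tau> (polar_angle x)) \<in> borel_measurable (lebesgue_on unit_disk)"
      by (rule borel_measurable_integrable)
    show "\<bar>norm x ^ k * \<tau> (polar_angle x)\<bar> \<le> 1" if "x \<in> space (lebesgue_on unit_disk)" for x
      using that \<tau>(2) by (auto simp: abs_mult space_restrict_space intro!: mult_le_one power_le_one)
  qed (use L2 exp in \<open>auto simp: L2_on_def has_angular_fourier_expansion_def\<close>)
  show "(\<lambda>N. LINT x|lebesgue_on unit_disk.
      fourier_partial_sum a b N (norm x) (polar_angle x) * (norm x ^ k * \<tau> (polar_angle x))) \<longlonglongrightarrow> c"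
    using const by (intro tendsto_eventually eventually_sequentiallyI)
qed

text \<open>Once \<open>N \<ge> m\<close>, orthogonality leaves the single mode m. For
  \<open>m = 0\<close> the survivor is the constant term, with angular integral 2 pi.
  \<open>Suc k\<close> includes the Jacobian.\<close>

lemma LINT_cos:
  "(LINT x|lebesgue_on unit_disk. \<gamma> x * (norm x ^ k * cos (real m * polar_angle x))) =
    pi * (if m = 0 then 2 else 1) * (LINT r|lebesgue_on {0<..<1}. r ^ Suc k * a m r)"
proof (rule LINT_expansion)
  fix N assume "N \<ge> m"
  have "continuous_on UNIV (\<lambda>\<phi>. cos (real m * \<phi>))" by (intro continuous_intros)
  note moment = fourier_partial_sum_moment(2)[OF radial_moments this]
  have z: "(LINT \<phi>|angles. cos (real m * \<phi>)) = (if m = 0 then 2 * pi else 0)"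
    using LINT_angles_cos_cos[of 0 m] by simp
  have "(LINT x|lebesgue_on unit_disk. fourier_partial_sum a b N (norm x) (polar_angle x) *
      (norm x ^ k * cos (real m * polar_angle x))) =
    (LINT r|lebesgue_on {0<..<1}. r * (a 0 r * r ^ k)) * (if m = 0 then 2 * pi else 0) +
    (\<Sum>n=1..N. if n = m then (LINT r|lebesgue_on {0<..<1}. r * (a n r * r ^ k)) * pi else 0)"
    unfolding moment
      LINT_angles_cos_cos LINT_angles_sin_cos z
    by (intro arg_cong2[where f = "(+)"] refl sum.cong) auto
  also have "\<dots> = pi * (if m = 0 then 2 else 1) * (LINT r|lebesgue_on {0<..<1}. r * (a m r * r ^ k))"
    using \<open>N \<ge> m\<close> by (cases "m = 0") (auto simp: sum.delta')
  finally show "(LINT x|lebesgue_on unit_disk. fourier_partial_sum a b N (norm x) (polar_angle x) *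
      (norm x ^ k * cos (real m * polar_angle x))) =
    pi * (if m = 0 then 2 else 1) * (LINT r|lebesgue_on {0<..<1}. r ^ Suc k * a m r)"
    by (simp add: mult_ac)
qed (auto intro!: continuous_intros)

text \<open>A sine has mean zero and is orthogonal to every cosine, so the constant term and all
  \<open>a n\<close> drop out.\<close>

lemma LINT_sin:
  assumes "m \<ge> 1"
  shows "(LINT x|lebesgue_on unit_disk. \<gamma> x * (norm x ^ k * sin (real m * polar_angle x))) =
    pi * (LINT r|lebesgue_on {0<..<1}. r ^ Suc k * b m r)"
proof (rule LINT_expansion)
  fix N assume "N \<ge> m"
  have "continuous_on UNIV (\<lambda>\<phi>. sin (real m * \<phi>))" by (intro continuous_intros)
  note moment = fourier_partial_sum_moment(2)[OF radial_moments this]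
  have cs: "(LINT \<phi>|angles. cos (real n * \<phi>) * sin (real m * \<phi>)) = 0" for n
    using LINT_angles_sin_cos[of m n] by (simp add: mult.commute)
  have "(LINT x|lebesgue_on unit_disk. fourier_partial_sum a b N (norm x) (polar_angle x) *
      (norm x ^ k * sin (real m * polar_angle x))) =
    (\<Sum>n=1..N. if n = m then (LINT r|lebesgue_on {0<..<1}. r * (b n r * r ^ k)) * pi else 0)"
    unfolding moment
      LINT_angles_sin_sin[OF assms] LINT_angles_sin cs mult_zero_right add_0_left
    by (intro sum.cong) auto
  also have "\<dots> = pi * (LINT r|lebesgue_on {0<..<1}. r * (b m r * r ^ k))"
    using \<open>N \<ge> m\<close> assms by (simp add: sum.delta')
  finally show "(LINT x|lebesgue_on unit_disk. fourier_partial_sum a b N (norm x) (polar_angle x) *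
      (norm x ^ k * sin (real m * polar_angle x))) =
    pi * (LINT r|lebesgue_on {0<..<1}. r ^ Suc k * b m r)"
    by (simp add: mult_ac)
qed (auto intro!: continuous_intros)

end

section \<open>The matrix entries\<close>

lemma suminf_ennreal_finite_nth:
  fixes f :: "nat \<Rightarrow> ennreal"
  assumes "(\<Sum>n. f n) < \<infinity>"
  shows "f n < \<infinity>"
proof -
  have "f n \<le> (\<Sum>n. f n)"
    using sum_le_suminf[of f "{n}"] by simp
  then show ?thesis using assms by (rule le_less_trans)
qed

lemma DN_derivative_polar:
  assumes f: "\<And>x. x \<in> unit_disk \<Longrightarrow> gradient (harmonic_extension f) x =
      vec_of_complex (cnj (\<alpha> * (of_nat i * complex_of_vec x ^ (i - 1))))"
    and g: "\<And>x. x \<in> unit_disk \<Longrightarrow> gradient (harmonic_extension g) x =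
      vec_of_complex (cnj (\<beta> * (of_nat j * complex_of_vec x ^ (j - 1))))"
    and "i \<ge> 1" "j \<ge> 1"
  shows "DN_derivative \<gamma> f g = real i * real j * (LINT x|lebesgue_on unit_disk.
    \<gamma> x * (norm x ^ (i + j - 2) * Re (\<beta> * cnj \<alpha> * cis ((real j - real i) * polar_angle x))))"
proof -
  have "DN_derivative \<gamma> f g = (LINT x|lebesgue_on unit_disk. real i * real j * (
    \<gamma> x * (norm x ^ (i + j - 2) * Re (\<beta> * cnj \<alpha> * cis ((real j - real i) * polar_angle x)))))"
    unfolding DN_derivative_def
  proof (rule Bochner_Integration.integral_cong[OF refl])
    fix x :: "real ^ 2" assume "x \<in> space (lebesgue_on unit_disk)"
    then have "x \<in> unit_disk" by (simp add: space_restrict_space)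
    then show "\<gamma> x * (gradient (harmonic_extension f) x \<bullet> gradient (harmonic_extension g) x) =
      real i * real j * (\<gamma> x *
        (norm x ^ (i + j - 2) * Re (\<beta> * cnj \<alpha> * cis ((real j - real i) * polar_angle x))))"
      by (simp only: f g inner_gradients_polar[OF assms(3,4)] mult_ac)
  qed
  then show ?thesis by simp
qed

theorem proposition1:
  fixes \<gamma> :: "real ^ 2 \<Rightarrow> real" and a b :: "nat \<Rightarrow> real \<Rightarrow> real" and i j :: nat
  assumes "L2_on unit_disk \<gamma>"
    and "has_angular_fourier_expansion \<gamma> a b"
    and "(\<Sum>n. \<integral>\<^sup>+r. ennreal ((a n r)\<^sup>2 * r) \<partial>lebesgue_on {0<..<1})
       + (\<Sum>n. \<integral>\<^sup>+r. ennreal ((b (Suc n) r)\<^sup>2 * r) \<partial>lebesgue_on {0<..<1}) < \<infinity>"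
    and "b 0 = (\<lambda>r. 0)"
    and "i \<ge> 1" and "j \<ge> 1"
  shows "K_cc \<gamma> i j = K_ss \<gamma> i j
       \<and> K_ss \<gamma> i j = real i * real j * pi * zeta i j *
           (LINT r | lebesgue_on {0<..<1}. r ^ (i + j - 1) * a (nat \<bar>int i - int j\<bar>) r)
       \<and> K_cs \<gamma> i j = K_sc \<gamma> j i
       \<and> K_sc \<gamma> j i = real i * real j * pi * sgn (real j - real i) *
           (LINT r | lebesgue_on {0<..<1}. r ^ (i + j - 1) * b (nat \<bar>int i - int j\<bar>) r)"
proof -
  let ?k = "i + j - 2" and ?m = "nat \<bar>int i - int j\<bar>"
  have fin: "(\<Sum>n. \<integral>\<^sup>+r. ennreal ((a n r)\<^sup>2 * r) \<partial>lebesgue_on {0<..<1}) < \<infinity>"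
    "(\<Sum>n. \<integral>\<^sup>+r. ennreal ((b (Suc n) r)\<^sup>2 * r) \<partial>lebesgue_on {0<..<1}) < \<infinity>"
    using assms(3) by (auto simp: less_top)
  have a: "(\<integral>\<^sup>+r. ennreal ((a n r)\<^sup>2 * r) \<partial>lebesgue_on {0<..<1}) < \<infinity>" for n
    using suminf_ennreal_finite_nth[OF fin(1)] .
  have b: "(\<integral>\<^sup>+r. ennreal ((b n r)\<^sup>2 * r) \<partial>lebesgue_on {0<..<1}) < \<infinity>" for n
    \<comment> \<open>The series runs over \<open>b (Suc n)\<close>, hence the shifted index; the
      remaining case \<open>n = 0\<close> is the convention that \<open>b 0\<close>
      vanishes.\<close>
    using suminf_ennreal_finite_nth[OF fin(2), of "n - 1"] assms(4) by (cases n) auto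
  have k: "Suc ?k = i + j - 1" using assms(5,6) by simp
  have m: "real ?m = \<bar>real j - real i\<bar>" by linarith
  \<comment> \<open>The frequency j - i may be negative, while modes are indexed by natural numbers.
    Parity passes to its absolute value, and the odd sine leaves the sign behind.\<close>
  have trig: "cos (x * \<phi>) = cos (\<bar>x\<bar> * \<phi>)" "sin (x * \<phi>) = sgn x * sin (\<bar>x\<bar> * \<phi>)" for x \<phi> :: real
    by (cases x "0::real" rule: linorder_cases; simp)+
  note c = trig(1)[of "real j - real i", folded m]
  note s = trig(2)[of "real j - real i", folded m]
  note C = LINT_cos[OF assms(1,2) a b, of ?k ?m, unfolded k]
  have cc: "K_cc \<gamma> i j = real i * real j * (LINT x|lebesgue_on unit_disk.
      \<gamma> x * (norm x ^ ?k * cos (real ?m * polar_angle x)))"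
    unfolding K_cc_def
    by (subst DN_derivative_polar[where i = i and j = j and \<alpha> = 1 and \<beta> = 1])
       (use assms(5,6) in \<open>auto simp: gradient_harmonic_extension_cos c\<close>)
  have ss: "K_ss \<gamma> i j = real i * real j * (LINT x|lebesgue_on unit_disk.
      \<gamma> x * (norm x ^ ?k * cos (real ?m * polar_angle x)))"
    unfolding K_ss_def
    by (subst DN_derivative_polar[where i = i and j = j and \<alpha> = "- \<i>" and \<beta> = "- \<i>"])
       (use assms(5,6) in \<open>auto simp: gradient_harmonic_extension_sin c\<close>)
  have cs: "K_cs \<gamma> i j = real i * real j * (LINT x|lebesgue_on unit_disk.
      \<gamma> x * (norm x ^ ?k * sin ((real j - real i) * polar_angle x)))"
    unfolding K_cs_def
    by (subst DN_derivative_polar[where i = i and j = j and \<alpha> = 1 and \<beta> = "- \<i>"])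
       (use assms(5,6) in \<open>auto simp: gradient_harmonic_extension_cos gradient_harmonic_extension_sin\<close>)
  have sc: "K_sc \<gamma> j i = K_cs \<gamma> i j"
    unfolding K_sc_def K_cs_def DN_derivative_def by (simp add: inner_commute)
  have "K_cs \<gamma> i j = real i * real j * pi * sgn (real j - real i) *
           (LINT r | lebesgue_on {0<..<1}. r ^ (i + j - 1) * b ?m r)"
  \<comment> \<open>On the diagonal both sides vanish, since sin 0 = 0 and \<open>sgn 0 = 0\<close>;
    off it the mode index is at least 1, as \<open>LINT_sin\<close> requires.\<close>
  proof (cases "i = j")
    case False
    then have m: "?m \<ge> 1" by linarith
    have "K_cs \<gamma> i j = real i * real j * (LINT x|lebesgue_on unit_disk.
      sgn (real j - real i) * (\<gamma> x * (norm x ^ ?k * sin (real ?m * polar_angle x))))"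
      unfolding cs s by (simp add: mult_ac)
    also have "\<dots> = real i * real j * (sgn (real j - real i) * (LINT x|lebesgue_on unit_disk.
      \<gamma> x * (norm x ^ ?k * sin (real ?m * polar_angle x))))" by simp
    finally show ?thesis
      unfolding LINT_sin[OF assms(1,2) a b m, of ?k, unfolded k] by (simp add: mult_ac)
  qed (use cs in simp)
  moreover have "(if ?m = 0 then 2 else 1) = zeta i j" by (auto simp: zeta_def)
  ultimately show ?thesis
    using cc ss sc C by simp
qed

end
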